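(* Let $f:\mathbb{R}_+^2\to\mathbb{R}_+$ be a homogeneous production function with two inputs. Then the production surface of $f$ has vanishing Gauss curvature if and only if either $f$ has constant return to scale or $f$ is a binomial production function.
   Context: $\mathbb{R}_+$ denotes the positive real numbers. A production function with $n$ inputs is a map $f:\mathbb{R}_+^n\to\mathbb{R}_+$ of class $C^\infty$, $f=f(x_1,\ldots,x_n)$, which is strictly increasing in each input in the sense that $f_{x_i}>0$ for all $i\in\{1,\ldots,n\}$. It is homogeneous if there is a real number $r$ such that $f(\lambda x)=\lambda^r f(x)$ for all $x\in\mathbb{R}_+^n$ and $\lambda\in\mathbb{R}_+$; if $r=1$, $f$ is said to have constant return to scale. For $n=2$, the production surface of $f$ is its graph $L(x_1,x_2)=(x_1,x_2,f(x_1,x_2))$ in Euclidean 3-space $\mathbb{E}^3$, with Gauss curvature $$K=\frac{f_{x_1x_1}f_{x_2x_2}-f_{x_1x_2}^2}{(1+f_{x_1}^2+f_{x_2}^2)^2}.$$ Vanishing Gauss curvature means $K\equiv 0$. A binomial production function is one of the form $f(x_1,x_2)=A(c_1x_1+c_2x_2)^\gamma$ with constants $A>0$, $\gamma>0$, $c_1>0$, $c_2>0$. *)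

theory Defs
  imports "HOL-Analysis.Analysis"
begin

definition pos_orthant :: "(real ^ 'n) set" where
  "pos_orthant = {x. \<forall>i. 0 < x $ i}"

definition partial_deriv :: "'n \<Rightarrow> (real ^ 'n \<Rightarrow> real) \<Rightarrow> real ^ 'n \<Rightarrow> real" where
  "partial_deriv i f x = deriv (\<lambda>t. f (x + t *\<^sub>R axis i 1)) 0"

text \<open>Class $C^k$ on a set, meant for open sets: $f$ is of class $C^{k+1}$ if it is differentiable
  and its derivative, i.e. every first-order partial derivative, is of class $C^k$.\<close>

primrec Ck_on :: "nat \<Rightarrow> (real ^ 'n \<Rightarrow> real) \<Rightarrow> (real ^ 'n) set \<Rightarrow> bool" where
  "Ck_on 0 f S \<longleftrightarrow> continuous_on S f"
| "Ck_on (Suc k) f S \<longleftrightarrow> f differentiable_on S \<and> (\<forall>i. Ck_on k (partial_deriv i f) S)"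

definition smooth_on :: "(real ^ 'n \<Rightarrow> real) \<Rightarrow> (real ^ 'n) set \<Rightarrow> bool" where
  "smooth_on f S \<longleftrightarrow> (\<forall>k. Ck_on k f S)"

text \<open>Production functions live on the positive orthant only. They are modelled by total functions
  whose values outside the (open) orthant are irrelevant to every notion below.\<close>

definition production_function :: "(real ^ 'n \<Rightarrow> real) \<Rightarrow> bool" where
  "production_function f \<longleftrightarrow>
     (\<forall>x\<in>pos_orthant. 0 < f x) \<and>
     smooth_on f pos_orthant \<and>
     (\<forall>i. \<forall>x\<in>pos_orthant. 0 < partial_deriv i f x)"

definition homogeneous_of_degree :: "real \<Rightarrow> (real ^ 'n \<Rightarrow> real) \<Rightarrow> bool" where
  "homogeneous_of_degree r f \<longleftrightarrow>
     (\<forall>x\<in>pos_orthant. \<forall>l>0. f (l *\<^sub>R x) = l powr r * f x)"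

definition homogeneous :: "(real ^ 'n \<Rightarrow> real) \<Rightarrow> bool" where
  "homogeneous f \<longleftrightarrow> (\<exists>r. homogeneous_of_degree r f)"

definition constant_return_to_scale :: "(real ^ 'n \<Rightarrow> real) \<Rightarrow> bool" where
  "constant_return_to_scale f \<longleftrightarrow> homogeneous_of_degree 1 f"

text \<open>Gauss curvature of the graph $(x_1, x_2, f(x_1,x_2))$ in Euclidean 3-space, at the point
  over $x$.\<close>

definition gauss_curvature :: "(real ^ 2 \<Rightarrow> real) \<Rightarrow> real ^ 2 \<Rightarrow> real" where
  "gauss_curvature f x =
     (partial_deriv 1 (partial_deriv 1 f) x * partial_deriv 2 (partial_deriv 2 f) x
        - (partial_deriv 2 (partial_deriv 1 f) x)\<^sup>2)
     / (1 + (partial_deriv 1 f x)\<^sup>2 + (partial_deriv 2 f x)\<^sup>2)\<^sup>2"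

definition vanishing_gauss_curvature :: "(real ^ 2 \<Rightarrow> real) \<Rightarrow> bool" where
  "vanishing_gauss_curvature f \<longleftrightarrow> (\<forall>x\<in>pos_orthant. gauss_curvature f x = 0)"

definition binomial_production_function :: "(real ^ 2 \<Rightarrow> real) \<Rightarrow> bool" where
  "binomial_production_function f \<longleftrightarrow>
     (\<exists>A \<gamma> c1 c2. 0 < A \<and> 0 < \<gamma> \<and> 0 < c1 \<and> 0 < c2 \<and>
        (\<forall>x\<in>pos_orthant. f x = A * (c1 * x $ 1 + c2 * x $ 2) powr \<gamma>))"

end

theory Submission
  imports Defs
begin

text \<open>A homogeneous function of degree $r$ on the positive quadrant is determined by its profile
  $h(u) = f(1, u)$ through $f(x_1, x_2) = x_1^r\, h(u)$ with $u = x_2 / x_1$. Both partial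
  derivatives are again of this shape, of degree $r - 1$ and with profiles $r h - u h'$ and $h'$.
  Differentiating twice, the terms with the factor $u$ cancel in the Hessian determinant, and
  \[ f_{11} f_{22} - f_{12}^2 = x_1^{2(r-2)}\, (r - 1)\, \bigl(r\, h\, h'' - (r - 1)\, h'^2\bigr) \]
  (lemma \<open>gauss_curvature_zero_iff_profile\<close>). Flatness thus means $r = 1$, which is constant
  return to scale, or the differential equation $r h h'' = (r - 1) h'^2$.

  The profile $A (c_1 + c_2 u)^r$ of a binomial function satisfies the equation. Conversely,
  monotonicity in both inputs makes $h'$ and $r h - u h'$ positive, so $r > 0$ because $h > 0$,
  and the equation says that $h^{1/r}$ has vanishing second derivative. Hence $h^{1/r} = c_1 + c_2 u$
  (lemma \<open>profile_ode_solution\<close>), where the same two positivity conditions give $c_2 > 0$ and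
  $c_1 > 0$, and $f = (c_1 x_1 + c_2 x_2)^r$.\<close>

section \<open>Partial derivatives on the positive quadrant\<close>

lemma mem_pos_orthant_2: "x \<in> pos_orthant \<longleftrightarrow> 0 < x $ 1 \<and> 0 < x $ 2" for x :: "real ^ 2"
  by (simp add: pos_orthant_def forall_2)

lemma open_pos_orthant: "open (pos_orthant :: (real ^ 'n) set)"
proof -
  have "pos_orthant = (\<Inter>i. {x :: real ^ 'n. 0 < x $ i})"
    by (auto simp: pos_orthant_def)
  also have "open \<dots>"
    by (intro open_INT ballI open_Collect_less continuous_intros) simp
  finally show ?thesis .
qed

lemma has_partial_deriv:
  fixes F :: "real ^ 'n \<Rightarrow> real"
  assumes "F differentiable_on S" "open S" "x \<in> S"
  shows "((\<lambda>t. F (x + t *\<^sub>R axis i 1)) has_real_derivative partial_deriv i F x) (at 0)"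
proof -
  let ?l = "\<lambda>t. x + t *\<^sub>R axis i 1 :: real ^ 'n"
  have l: "?l differentiable (at 0)"
    by (rule differentiableI[where f' = "\<lambda>t. t *\<^sub>R axis i 1"])
      (auto intro!: derivative_eq_intros)
  have "F differentiable (at x within S)"
    using assms(1,3) by (simp add: differentiable_on_def)
  then have "F differentiable (at (?l 0))"
    by (simp add: at_within_open[OF assms(3,2)])
  with l have "(F \<circ> ?l) differentiable (at 0)"
    by (rule differentiable_chain_at)
  then have "(\<lambda>t. F (?l t)) differentiable (at 0)"
    by (simp only: o_def)
  then show ?thesis
    unfolding partial_deriv_def by (rule DERIV_deriv_iff_real_differentiable[THEN iffD2])
qed

text \<open>A section along a coordinate line stays in the quadrant for small parameters, so a formula
  valid on the quadrant alone determines the partial derivatives there.\<close>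

lemma partial_deriv_1_eqI:
  fixes F :: "real ^ 2 \<Rightarrow> real"
  assumes eq: "\<And>x. x \<in> pos_orthant \<Longrightarrow> F x = \<phi> (x $ 1) (x $ 2)"
    and x: "x \<in> pos_orthant"
    and D: "((\<lambda>s. \<phi> s (x $ 2)) has_real_derivative D) (at (x $ 1))"
  shows "partial_deriv 1 F x = D"
proof -
  have "((\<lambda>t. \<phi> (x $ 1 + t) (x $ 2)) has_real_derivative D) (at 0)"
    using D DERIV_shift[of "\<lambda>s. \<phi> s (x $ 2)" D 0 "x $ 1"] by (simp add: add.commute[of _ "x $ 1"])
  moreover have "\<forall>\<^sub>F t in nhds 0. F (x + t *\<^sub>R axis 1 1) = \<phi> (x $ 1 + t) (x $ 2)"
  proof (rule eventually_nhds_in_open[of "{- x $ 1 <..}", THEN eventually_mono])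
    fix t assume "t \<in> {- x $ 1 <..}"
    with x have "x + t *\<^sub>R axis 1 1 \<in> pos_orthant"
      by (simp add: mem_pos_orthant_2 axis_def)
    then show "F (x + t *\<^sub>R axis 1 1) = \<phi> (x $ 1 + t) (x $ 2)"
      by (simp add: eq axis_def)
  qed (use x in \<open>auto simp: mem_pos_orthant_2\<close>)
  ultimately have "((\<lambda>t. F (x + t *\<^sub>R axis 1 1)) has_real_derivative D) (at 0)"
    using DERIV_cong_ev[OF refl _ refl] by fastforce
  then show ?thesis
    unfolding partial_deriv_def by (rule DERIV_imp_deriv)
qed

lemma partial_deriv_2_eqI:
  fixes F :: "real ^ 2 \<Rightarrow> real"
  assumes eq: "\<And>x. x \<in> pos_orthant \<Longrightarrow> F x = \<phi> (x $ 1) (x $ 2)"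
    and x: "x \<in> pos_orthant"
    and D: "((\<lambda>s. \<phi> (x $ 1) s) has_real_derivative D) (at (x $ 2))"
  shows "partial_deriv 2 F x = D"
proof -
  have "((\<lambda>t. \<phi> (x $ 1) (x $ 2 + t)) has_real_derivative D) (at 0)"
    using D DERIV_shift[of "\<lambda>s. \<phi> (x $ 1) s" D 0 "x $ 2"] by (simp add: add.commute[of _ "x $ 2"])
  moreover have "\<forall>\<^sub>F t in nhds 0. F (x + t *\<^sub>R axis 2 1) = \<phi> (x $ 1) (x $ 2 + t)"
  proof (rule eventually_nhds_in_open[of "{- x $ 2 <..}", THEN eventually_mono])
    fix t assume "t \<in> {- x $ 2 <..}"
    with x have "x + t *\<^sub>R axis 2 1 \<in> pos_orthant"
      by (simp add: mem_pos_orthant_2 axis_def)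
    then show "F (x + t *\<^sub>R axis 2 1) = \<phi> (x $ 1) (x $ 2 + t)"
      by (simp add: eq axis_def)
  qed (use x in \<open>auto simp: mem_pos_orthant_2\<close>)
  ultimately have "((\<lambda>t. F (x + t *\<^sub>R axis 2 1)) has_real_derivative D) (at 0)"
    using DERIV_cong_ev[OF refl _ refl] by fastforce
  then show ?thesis
    unfolding partial_deriv_def by (rule DERIV_imp_deriv)
qed

section \<open>Homogeneous functions and their profiles\<close>

text \<open>The profile is an explicit parameter, so that partial derivatives, which are homogeneous of
  degree $r - 1$, fall under the same lemmas as the function itself and can be differentiated
  once more.\<close>

definition has_profile :: "real \<Rightarrow> (real \<Rightarrow> real) \<Rightarrow> (real ^ 2 \<Rightarrow> real) \<Rightarrow> bool" where
  "has_profile r h F \<longleftrightarrow> (\<forall>x\<in>pos_orthant. F x = (x $ 1) powr r * h (x $ 2 / x $ 1))"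

lemma homogeneous_has_profile:
  assumes "homogeneous_of_degree r f"
  shows "has_profile r (\<lambda>u. f (vector [1, u])) f"
  unfolding has_profile_def
proof
  fix x :: "real ^ 2" assume x: "x \<in> pos_orthant"
  let ?z = "vector [1, x $ 2 / x $ 1] :: real ^ 2"
  have "?z \<in> pos_orthant" "0 < x $ 1"
    using x by (auto simp: mem_pos_orthant_2)
  moreover have "x = (x $ 1) *\<^sub>R ?z"
    using \<open>0 < x $ 1\<close> by (simp add: vec_eq_iff forall_2)
  ultimately show "f x = (x $ 1) powr r * f ?z"
    using assms unfolding homogeneous_of_degree_def by metis
qed

text \<open>Euler's relation $x_1 f_{1} + x_2 f_{2} = r f$, with $f_{2}$ of profile $h'$, is what makes
  $r h - u h'$ the profile of $f_{1}$.\<close>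

lemma has_profile_partial_deriv_1:
  assumes F: "has_profile r h F"
    and h: "\<And>u. 0 < u \<Longrightarrow> (h has_real_derivative h' u) (at u)"
  shows "has_profile (r - 1) (\<lambda>u. r * h u - u * h' u) (partial_deriv 1 F)"
  unfolding has_profile_def
proof
  fix x :: "real ^ 2" assume x: "x \<in> pos_orthant"
  then have pos: "0 < x $ 1" "0 < x $ 2" by (auto simp: mem_pos_orthant_2)
  have "((\<lambda>s. x $ 2 / s) has_real_derivative - (x $ 2) / (x $ 1)\<^sup>2) (at (x $ 1))"
    using pos by (auto intro!: derivative_eq_intros simp: power2_eq_square)
  from DERIV_chain2[OF h this] pos
  have "((\<lambda>s. h (x $ 2 / s)) has_real_derivative
      h' (x $ 2 / x $ 1) * (- (x $ 2) / (x $ 1)\<^sup>2)) (at (x $ 1))"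
    by simp
  from DERIV_mult[OF has_real_derivative_powr[OF pos(1), of r] this]
  have "((\<lambda>s. s powr r * h (x $ 2 / s)) has_real_derivative
      (x $ 1) powr (r - 1) * (r * h (x $ 2 / x $ 1) - x $ 2 / x $ 1 * h' (x $ 2 / x $ 1)))
      (at (x $ 1))"
    by (rule DERIV_cong) (use pos in \<open>simp add: powr_diff field_simps power2_eq_square\<close>)
  from partial_deriv_1_eqI[where \<phi> = "\<lambda>s t. s powr r * h (t / s)", OF _ x this]
  show "partial_deriv 1 F x =
      (x $ 1) powr (r - 1) * (r * h (x $ 2 / x $ 1) - x $ 2 / x $ 1 * h' (x $ 2 / x $ 1))"
    using F unfolding has_profile_def by blast
qed

lemma has_profile_partial_deriv_2:
  assumes F: "has_profile r h F"
    and h: "\<And>u. 0 < u \<Longrightarrow> (h has_real_derivative h' u) (at u)"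
  shows "has_profile (r - 1) h' (partial_deriv 2 F)"
  unfolding has_profile_def
proof
  fix x :: "real ^ 2" assume x: "x \<in> pos_orthant"
  then have pos: "0 < x $ 1" "0 < x $ 2" by (auto simp: mem_pos_orthant_2)
  have "((\<lambda>t. t / x $ 1) has_real_derivative 1 / x $ 1) (at (x $ 2))"
    using pos by (auto intro!: derivative_eq_intros)
  from DERIV_chain2[OF h this] pos
  have "((\<lambda>t. h (t / x $ 1)) has_real_derivative h' (x $ 2 / x $ 1) * (1 / x $ 1)) (at (x $ 2))"
    by simp
  from DERIV_cmult[OF this, of "(x $ 1) powr r"]
  have "((\<lambda>t. (x $ 1) powr r * h (t / x $ 1)) has_real_derivative
      (x $ 1) powr (r - 1) * h' (x $ 2 / x $ 1)) (at (x $ 2))"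
    by (rule DERIV_cong) (use pos in \<open>simp add: powr_diff\<close>)
  from partial_deriv_2_eqI[where \<phi> = "\<lambda>s t. s powr r * h (t / s)", OF _ x this]
  show "partial_deriv 2 F x = (x $ 1) powr (r - 1) * h' (x $ 2 / x $ 1)"
    using F unfolding has_profile_def by blast
qed

section \<open>Curvature in terms of the profile\<close>

text \<open>Flatness is scale invariant, hence a condition on the ratio $u$ of the inputs alone.\<close>

lemma gauss_curvature_zero_iff_profile:
  assumes F: "has_profile r h F"
    and h: "\<And>u. 0 < u \<Longrightarrow> (h has_real_derivative h' u) (at u)"
    and h': "\<And>u. 0 < u \<Longrightarrow> (h' has_real_derivative h'' u) (at u)"
    and x: "x \<in> pos_orthant" and u: "u = x $ 2 / x $ 1"
  shows "gauss_curvature F x = 0 \<longleftrightarrow> r = 1 \<or> r * h u * h'' u = (r - 1) * (h' u)\<^sup>2"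
proof -
  have pos: "0 < x $ 1" using x by (auto simp: mem_pos_orthant_2)
  define p where "p = (x $ 1) powr (r - 1 - 1)"
  have p: "p \<noteq> 0" using pos by (simp add: p_def)
  note F1 = has_profile_partial_deriv_1[OF F h]
  note F2 = has_profile_partial_deriv_2[OF F h]
  have D1: "((\<lambda>u. r * h u - u * h' u) has_real_derivative
      r * h' u - (h' u + u * h'' u)) (at u)" if "0 < u" for u
    by (rule derivative_eq_intros h[OF that] h'[OF that] refl)+ simp
  have F11: "partial_deriv 1 (partial_deriv 1 F) x =
      p * ((r - 1) * (r * h u - u * h' u) - u * (r * h' u - (h' u + u * h'' u)))"
    using has_profile_partial_deriv_1[OF F1 D1] x by (simp add: has_profile_def p_def u)
  have F12: "partial_deriv 2 (partial_deriv 1 F) x = p * (r * h' u - (h' u + u * h'' u))"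
    using has_profile_partial_deriv_2[OF F1 D1] x by (simp add: has_profile_def p_def u)
  have F22: "partial_deriv 2 (partial_deriv 2 F) x = p * h'' u"
    using has_profile_partial_deriv_2[OF F2 h'] x by (simp add: has_profile_def p_def u)
  have "1 + (partial_deriv 1 F x)\<^sup>2 + (partial_deriv 2 F x)\<^sup>2 \<noteq> 0"
    by (smt (verit) zero_le_power2)
  then have "gauss_curvature F x = 0 \<longleftrightarrow>
      partial_deriv 1 (partial_deriv 1 F) x * partial_deriv 2 (partial_deriv 2 F) x
        - (partial_deriv 2 (partial_deriv 1 F) x)\<^sup>2 = 0"
    by (simp add: gauss_curvature_def)
  also have "partial_deriv 1 (partial_deriv 1 F) x * partial_deriv 2 (partial_deriv 2 F) x
        - (partial_deriv 2 (partial_deriv 1 F) x)\<^sup>2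
      = p\<^sup>2 * ((r - 1) * (r * h u * h'' u - (r - 1) * (h' u)\<^sup>2))"
    unfolding F11 F12 F22 by (simp add: algebra_simps power2_eq_square)
  finally show ?thesis using p by simp
qed

corollary vanishing_gauss_curvature_iff_profile:
  assumes F: "has_profile r h F"
    and h: "\<And>u. 0 < u \<Longrightarrow> (h has_real_derivative h' u) (at u)"
    and h': "\<And>u. 0 < u \<Longrightarrow> (h' has_real_derivative h'' u) (at u)"
  shows "vanishing_gauss_curvature F \<longleftrightarrow>
    r = 1 \<or> (\<forall>u>0. r * h u * h'' u = (r - 1) * (h' u)\<^sup>2)"
proof
  assume K: "vanishing_gauss_curvature F"
  show "r = 1 \<or> (\<forall>u>0. r * h u * h'' u = (r - 1) * (h' u)\<^sup>2)"
  proof (cases "r = 1")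
    case False
    have "r * h u * h'' u = (r - 1) * (h' u)\<^sup>2" if "0 < u" for u
    proof -
      have x: "(vector [1, u] :: real ^ 2) \<in> pos_orthant" using that by (simp add: mem_pos_orthant_2)
      with K have "gauss_curvature F (vector [1, u]) = 0"
        by (simp add: vanishing_gauss_curvature_def)
      with gauss_curvature_zero_iff_profile[OF F h h' x, of u] False show ?thesis by simp
    qed
    then show ?thesis by blast
  qed simp
next
  assume R: "r = 1 \<or> (\<forall>u>0. r * h u * h'' u = (r - 1) * (h' u)\<^sup>2)"
  show "vanishing_gauss_curvature F"
    unfolding vanishing_gauss_curvature_def
  proof
    fix x :: "real ^ 2" assume x: "x \<in> pos_orthant"
    then have "0 < x $ 2 / x $ 1" by (simp add: mem_pos_orthant_2)
    with R gauss_curvature_zero_iff_profile[OF F h h' x refl]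
    show "gauss_curvature F x = 0" by blast
  qed
qed

lemma profile_of_smooth_homogeneous:
  fixes f :: "real ^ 2 \<Rightarrow> real"
  assumes sm: "smooth_on f pos_orthant" and hom: "homogeneous_of_degree r f"
  obtains h h' h'' where "has_profile r h f"
    and "\<And>u. 0 < u \<Longrightarrow> (h has_real_derivative h' u) (at u)"
    and "\<And>u. 0 < u \<Longrightarrow> (h' has_real_derivative h'' u) (at u)"
proof -
  have "Ck_on (Suc (Suc 0)) f pos_orthant"
    using sm by (simp only: smooth_on_def)
  then have d: "f differentiable_on pos_orthant" "partial_deriv 2 f differentiable_on pos_orthant"
    by auto
  have line: "((\<lambda>u. F (vector [1, u])) has_real_derivative
      partial_deriv 2 F (vector [1, u])) (at u)"
    if F: "F differentiable_on pos_orthant" and u: "0 < u" for F :: "real ^ 2 \<Rightarrow> real" and u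
  proof -
    have "(vector [1, u] :: real ^ 2) \<in> pos_orthant" using u by (simp add: mem_pos_orthant_2)
    from has_partial_deriv[OF F open_pos_orthant this, of 2]
    have "((\<lambda>t. F (vector [1, u] + t *\<^sub>R axis 2 1)) has_real_derivative
        partial_deriv 2 F (vector [1, u])) (at 0)" .
    moreover have "vector [1, u] + t *\<^sub>R axis 2 1 = (vector [1, t + u] :: real ^ 2)" for t
      by (simp add: vec_eq_iff forall_2 axis_def)
    ultimately show ?thesis
      using DERIV_shift[of "\<lambda>u. F (vector [1, u])" _ 0 u] by simp
  qed
  show thesis
  proof (rule that)
    show "has_profile r (\<lambda>u. f (vector [1, u])) f"
      by (rule homogeneous_has_profile[OF hom])
    show "((\<lambda>u. f (vector [1, u])) has_real_derivative
        partial_deriv 2 f (vector [1, u])) (at u)" if "0 < u" for u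
      using line[OF d(1) that] .
    show "((\<lambda>u. partial_deriv 2 f (vector [1, u])) has_real_derivative
        partial_deriv 2 (partial_deriv 2 f) (vector [1, u])) (at u)" if "0 < u" for u
      using line[OF d(2) that] .
  qed
qed

section \<open>Flat profiles\<close>

text \<open>The equation makes $g = h^{1/r}$ affine: $r g' = h^{1/r - 1} h'$ has the derivative
  $h^{1/r-2}\, \bigl(h h'' - (1 - 1/r) h'^2\bigr) = 0$. The slope $c_2 = g'(1)$ is positive because
  $h$ increases, and $c_1 = g(1) - g'(1)$ is a positive multiple of $r h(1) - h'(1)$.\<close>

lemma profile_ode_solution:
  fixes h h' h'' :: "real \<Rightarrow> real"
  assumes h: "\<And>u. 0 < u \<Longrightarrow> (h has_real_derivative h' u) (at u)"
    and h': "\<And>u. 0 < u \<Longrightarrow> (h' has_real_derivative h'' u) (at u)"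
    and pos: "\<And>u. 0 < u \<Longrightarrow> 0 < h u" and r: "0 < r"
    and ode: "\<And>u. 0 < u \<Longrightarrow> r * h u * h'' u = (r - 1) * (h' u)\<^sup>2"
    and h'_pos: "\<And>u. 0 < u \<Longrightarrow> 0 < h' u"
    and euler_pos: "\<And>u. 0 < u \<Longrightarrow> 0 < r * h u - u * h' u"
  obtains c1 c2 where "0 < c1" "0 < c2" "\<And>u. 0 < u \<Longrightarrow> h u = (c1 + c2 * u) powr r"
proof -
  define g where "g u = h u powr (1/r)" for u
  define g' where "g' u = g u * h' u / (r * h u)" for u
  have g: "(g has_real_derivative g' u) (at u)" if u: "0 < u" for u
  proof -
    have root: "h u powr (1/r - 1) = g u / h u"
      using pos[OF u] by (subst powr_diff) (simp add: g_def)
    have "(g has_real_derivative 1/r * h u powr (1/r - 1) * h' u) (at u)"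
      using DERIV_fun_powr[OF h[OF u] pos[OF u], of "1/r"] by (simp add: g_def[abs_def])
    then show ?thesis by (simp add: root g'_def)
  qed
  have g': "(g' has_real_derivative 0) (at u)" if u: "0 < u" for u
  proof -
    have nz: "r * h u \<noteq> 0" using r pos[OF u] by simp
    have "(g' has_real_derivative
        ((g' u * h' u + h'' u * g u) * (r * h u) - (g u * h' u) * (r * h' u))
        / ((r * h u) * (r * h u))) (at u)"
      unfolding g'_def[abs_def]
      by (rule DERIV_divide[OF DERIV_mult[OF g[OF u, unfolded g'_def] h'[OF u]]
            DERIV_cmult[OF h[OF u], of r] nz])
    moreover have "(g' u * h' u + h'' u * g u) * (r * h u) - (g u * h' u) * (r * h' u)
        = g u * (r * h u * h'' u - (r - 1) * (h' u)\<^sup>2)"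
    proof -
      have "g' u * (r * h u) = g u * h' u" using nz by (simp add: g'_def)
      moreover have "(g' u * h' u + h'' u * g u) * (r * h u) - (g u * h' u) * (r * h' u)
          = g' u * (r * h u) * h' u + g u * (r * h u * h'' u - r * (h' u)\<^sup>2)"
        by (simp add: algebra_simps power2_eq_square)
      ultimately show ?thesis by (simp only:) (simp add: algebra_simps power2_eq_square)
    qed
    ultimately show ?thesis using ode[OF u] by simp
  qed
  define c2 where "c2 = g' 1"
  define c1 where "c1 = g 1 - c2"
  have const_on_pos: "k u = k 1"
    if "\<And>u. 0 < u \<Longrightarrow> (k has_real_derivative 0) (at u)" "0 < u" for k :: "real \<Rightarrow> real" and u
  proof -
    have "\<exists>c. \<forall>u\<in>{0<..}. k u = c"
      by (rule has_field_derivative_zero_constant)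
        (use that(1) in \<open>auto intro: has_field_derivative_at_within\<close>)
    then show ?thesis using \<open>0 < u\<close> by fastforce
  qed
  have const: "g' u = c2" if "0 < u" for u
    unfolding c2_def by (rule const_on_pos[OF g' that])
  have affine: "g u = c1 + c2 * u" if u: "0 < u" for u
  proof -
    have "((\<lambda>u. g u - c2 * u) has_real_derivative 0) (at v)" if "0 < v" for v
      by (rule derivative_eq_intros g[OF that] refl)+ (simp add: const that)
    from const_on_pos[OF this u] show ?thesis by (simp add: c1_def)
  qed
  have g1: "0 < g 1" using pos[of 1] by (simp add: g_def)
  have c2: "0 < c2"
    using g1 pos[of 1] h'_pos[of 1] r by (simp add: c2_def g'_def)
  have c1: "0 < c1"
  proof -
    have "r * h 1 \<noteq> 0" using pos[of 1] r by simp
    then have "c1 = g 1 * (r * h 1 - 1 * h' 1) / (r * h 1)"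
      unfolding c1_def c2_def g'_def by (simp only: right_diff_distrib diff_divide_distrib) simp
    then show ?thesis using g1 pos[of 1] euler_pos[of 1] r by simp
  qed
  have "h u = (c1 + c2 * u) powr r" if "0 < u" for u
  proof -
    have "g u powr r = h u" using pos[OF that] r by (simp add: g_def powr_powr)
    then show ?thesis using affine[OF that] by simp
  qed
  with c1 c2 show thesis by (rule that)
qed

section \<open>Binomial functions and the classification\<close>

lemma binomial_has_profile:
  assumes "0 < c1" "0 < c2"
    and f: "\<And>x. x \<in> pos_orthant \<Longrightarrow> f x = A * (c1 * x $ 1 + c2 * x $ 2) powr \<gamma>"
  shows "has_profile \<gamma> (\<lambda>u. A * (c1 + c2 * u) powr \<gamma>) f"
  unfolding has_profile_def
proof
  fix x :: "real ^ 2" assume x: "x \<in> pos_orthant"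
  then have pos: "0 < x $ 1" "0 < x $ 2" by (auto simp: mem_pos_orthant_2)
  then have "c1 * x $ 1 + c2 * x $ 2 = x $ 1 * (c1 + c2 * (x $ 2 / x $ 1))"
    by (simp add: field_simps)
  moreover have "0 < c1 + c2 * (x $ 2 / x $ 1)"
    using pos assms(1,2) by (intro add_pos_pos) auto
  ultimately show "f x = (x $ 1) powr \<gamma> * (A * (c1 + c2 * (x $ 2 / x $ 1)) powr \<gamma>)"
    using f[OF x] pos by (simp add: powr_mult)
qed

text \<open>Along the profile $h = A\, l^\gamma$ with $l = c_1 + c_2 u$, both sides of the flatness equation
  are $A^2 \gamma^2 (\gamma - 1)\, c_2^2\, l^{2 \gamma - 2}$.\<close>

lemma binomial_flat:
  assumes "binomial_production_function f"
  shows "vanishing_gauss_curvature f"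
proof -
  obtain A \<gamma> c1 c2 where c: "0 < c1" "0 < c2"
    and f: "\<And>x. x \<in> pos_orthant \<Longrightarrow> f x = A * (c1 * x $ 1 + c2 * x $ 2) powr \<gamma>"
    using assms unfolding binomial_production_function_def by blast
  have D: "((\<lambda>u. a * (c1 + c2 * u) powr q) has_real_derivative
      (a * q * c2) * (c1 + c2 * u) powr (q - 1)) (at u)" if "0 < u" for a q u
  proof -
    have l: "0 < c1 + c2 * u" using c that by (intro add_pos_pos) auto
    have "((\<lambda>u. c1 + c2 * u) has_real_derivative c2) (at u)"
      by (auto intro!: derivative_eq_intros)
    from DERIV_cmult[OF DERIV_fun_powr[OF this l, of q], of a] show ?thesis
      by (simp add: mult_ac)
  qed
  have "\<gamma> * (A * (c1 + c2 * u) powr \<gamma>) *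
        (A * \<gamma> * c2 * (\<gamma> - 1) * c2 * (c1 + c2 * u) powr (\<gamma> - 1 - 1))
      = (\<gamma> - 1) * (A * \<gamma> * c2 * (c1 + c2 * u) powr (\<gamma> - 1))\<^sup>2" if "0 < u" for u
  proof -
    have "0 < c1 + c2 * u" using c that by (intro add_pos_pos) auto
    then show ?thesis by (simp add: powr_diff power2_eq_square)
  qed
  with vanishing_gauss_curvature_iff_profile[OF binomial_has_profile[OF c f] D D]
  show ?thesis by blast
qed

lemma flat_imp_crs_or_binomial:
  assumes prod: "production_function f" and hom: "homogeneous_of_degree r f"
    and K: "vanishing_gauss_curvature f"
  shows "constant_return_to_scale f \<or> binomial_production_function f"
proof (cases "r = 1")
  case True
  then show ?thesis using hom by (simp add: constant_return_to_scale_def)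
next
  case False
  have sm: "smooth_on f pos_orthant" using prod by (simp add: production_function_def)
  obtain h h' h'' where F: "has_profile r h f"
    and h: "\<And>u. 0 < u \<Longrightarrow> (h has_real_derivative h' u) (at u)"
    and h': "\<And>u. 0 < u \<Longrightarrow> (h' has_real_derivative h'' u) (at u)"
    by (rule profile_of_smooth_homogeneous[OF sm hom]) blast
  have ode: "r * h u * h'' u = (r - 1) * (h' u)\<^sup>2" if "0 < u" for u
    using vanishing_gauss_curvature_iff_profile[OF F h h'] K False that by blast
  have pos: "0 < h u" "0 < h' u" "0 < r * h u - u * h' u" if "0 < u" for u
  proof -
    have x: "(vector [1, u] :: real ^ 2) \<in> pos_orthant" using that by (simp add: mem_pos_orthant_2)
    then have "0 < f (vector [1, u])" "0 < partial_deriv 2 f (vector [1, u])"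
        "0 < partial_deriv 1 f (vector [1, u])"
      using prod by (auto simp: production_function_def)
    moreover have "f (vector [1, u]) = h u"
      using F x by (simp add: has_profile_def)
    moreover have "partial_deriv 2 f (vector [1, u]) = h' u"
      using has_profile_partial_deriv_2[OF F h] x by (simp add: has_profile_def)
    moreover have "partial_deriv 1 f (vector [1, u]) = r * h u - u * h' u"
      using has_profile_partial_deriv_1[OF F h] x by (simp add: has_profile_def)
    ultimately show "0 < h u" "0 < h' u" "0 < r * h u - u * h' u" by simp_all
  qed
  have "0 < r * h 1" using pos(2,3)[of 1] by simp
  then have r: "0 < r" using pos(1)[of 1] by (simp add: zero_less_mult_iff)
  obtain c1 c2 where c: "0 < c1" "0 < c2"
    and sol: "\<And>u. 0 < u \<Longrightarrow> h u = (c1 + c2 * u) powr r"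
    by (rule profile_ode_solution[OF h h' pos(1) r ode pos(2,3)]) blast+
  have "f x = 1 * (c1 * x $ 1 + c2 * x $ 2) powr r" if x: "x \<in> pos_orthant" for x
  proof -
    have "0 < x $ 2 / x $ 1" using x by (simp add: mem_pos_orthant_2)
    \<comment> \<open>Both sides have degree $r$ and the same profile.\<close>
    then show ?thesis
      using F x sol binomial_has_profile[OF c, of "\<lambda>x. 1 * (c1 * x $ 1 + c2 * x $ 2) powr r" 1 r]
      by (simp add: has_profile_def)
  qed
  then show ?thesis
    unfolding binomial_production_function_def using c r zero_less_one by blast
qed

theorem theorem4p1:
  fixes f :: "real ^ 2 \<Rightarrow> real"
  assumes "production_function f" and "homogeneous f"
  shows "vanishing_gauss_curvature f \<longleftrightarrow>
           constant_return_to_scale f \<or> binomial_production_function f"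
proof
  assume "vanishing_gauss_curvature f"
  then show "constant_return_to_scale f \<or> binomial_production_function f"
    using flat_imp_crs_or_binomial assms unfolding homogeneous_def by blast
next
  have sm: "smooth_on f pos_orthant" using assms by (simp add: production_function_def)
  assume "constant_return_to_scale f \<or> binomial_production_function f"
  then show "vanishing_gauss_curvature f"
  proof
    assume "constant_return_to_scale f"
    then have hom: "homogeneous_of_degree 1 f" by (simp add: constant_return_to_scale_def)
    obtain h h' h'' where "has_profile 1 h f"
      and "\<And>u. 0 < u \<Longrightarrow> (h has_real_derivative h' u) (at u)"
      and "\<And>u. 0 < u \<Longrightarrow> (h' has_real_derivative h'' u) (at u)"
      by (rule profile_of_smooth_homogeneous[OF sm hom]) blast
    from vanishing_gauss_curvature_iff_profile[OF this] show ?thesis by simp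
  qed (rule binomial_flat)
qed

end
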